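(* Let $(X,e)$ be a quasi-metric space and let $T:X\to X$ be a continuous map. Let $d_e$ be the metric on $X$ given by $d_e(x,y)=\frac{e(x,y)+e(y,x)}{2}$. Then $$h_{d_e}(T)=h'_e(T).$$
   Context: A quasi-metric on a set $X$ is a function $e:X\times X\to[0,+\infty)$ such that for all $x,y,z\in X$: $e(x,y)\ge 0$; $e(x,y)=0$ if and only if $x=y$; and $e(x,z)\le e(x,y)+e(y,z)$ (symmetry is not required). The space $X$ carries the topology generated by the sets $B_t(p)=\{x\in X: e(x,p)<t \text{ and } e(p,x)<t\}$, $p\in X$, $t>0$; this coincides with the topology of the metric $d_e$. Continuity and compactness refer to this topology. Entropy for the quasi-metric: for $n\ge 1$ put $e_n(x,y)=\max_{0\le i\le n-1}e(T^i(x),T^i(y))$. For $K\subseteq X$ compact and $\epsilon>0$, a subset $F\subseteq X$ is an $(n,\epsilon)$-spanning set of $K$ with respect to $T$ and $e$ if for every $x\in K$ there is $y\in F$ with $e_n(x,y)\le\epsilon$ and $e_n(y,x)\le\epsilon$. Let $r'_n(\epsilon,K,T,e)$ be the smallest cardinality of such a set, and define $$h'_e(T)=\sup_K\lim_{\epsilon\to 0}\limsup_{n\to\infty}\frac{\log r'_n(\epsilon,K,T,e)}{n},$$ the supremum being over all compact subsets $K$ of $X$. Entropy for a metric $d$ on $X$ (Bowen's definition): put $d_n(x,y)=\max_{0\le i\le n-1}d(T^i(x),T^i(y))$; a subset $F\subseteq X$ is an $(n,\epsilon)$-spanning set for $K$ with respect to $d$ and $T$ if for every $x\in K$ there is $y\in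 F$ with $d_n(x,y)\le\epsilon$; $r_n(\epsilon,K,T,d)$ is the smallest cardinality of such a set; and $$h_d(T)=\sup_K\lim_{\epsilon\to 0}\limsup_{n\to\infty}\frac{\log r_n(\epsilon,K,T,d)}{n},$$ the supremum being over all compact subsets $K$ of $X$. Entropies take extended real values, with the convention $\log 0=-\infty$ (relevant only for $K=\emptyset$). *)

theory Defs
  imports "HOL-Analysis.Analysis" "HOL-Library.Extended_Nat"
begin

text \<open>
  The carrier \<open>X\<close> is an explicit, possibly empty set. As in the library locale
  \<^locale>\<open>Metric_space\<close>, the distance is a total function of type \<open>'a \<Rightarrow> 'a \<Rightarrow> real\<close> that is
  nonnegative everywhere. Values off \<open>X\<close> play no role.
\<close>

locale Quasi_metric_space =
  fixes X :: "'a set" and e :: "'a \<Rightarrow> 'a \<Rightarrow> real"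
  assumes nonneg: "\<And>x y. 0 \<le> e x y"
    and zero: "\<And>x y. \<lbrakk>x \<in> X; y \<in> X\<rbrakk> \<Longrightarrow> e x y = 0 \<longleftrightarrow> x = y"
    and triangle: "\<And>x y z. \<lbrakk>x \<in> X; y \<in> X; z \<in> X\<rbrakk> \<Longrightarrow> e x z \<le> e x y + e y z"

definition qball :: "'a set \<Rightarrow> ('a \<Rightarrow> 'a \<Rightarrow> real) \<Rightarrow> 'a \<Rightarrow> real \<Rightarrow> 'a set" where
  "qball X e p t = {x \<in> X. e x p < t \<and> e p x < t}"

definition qtopology :: "'a set \<Rightarrow> ('a \<Rightarrow> 'a \<Rightarrow> real) \<Rightarrow> 'a topology" where
  "qtopology X e = topology_generated_by {qball X e p t | p t. p \<in> X \<and> 0 < t}"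

definition sym_metric :: "('a \<Rightarrow> 'a \<Rightarrow> real) \<Rightarrow> 'a \<Rightarrow> 'a \<Rightarrow> real" where
  "sym_metric e x y = (e x y + e y x) / 2"

text \<open>Only \<open>n \<ge> 1\<close> is meaningful; \<open>n = 0\<close> is invisible to the limit superior in \<open>n\<close> below.\<close>

definition dyn_dist :: "('a \<Rightarrow> 'a \<Rightarrow> real) \<Rightarrow> ('a \<Rightarrow> 'a) \<Rightarrow> nat \<Rightarrow> 'a \<Rightarrow> 'a \<Rightarrow> real" where
  "dyn_dist e T n x y = Max ((\<lambda>i. e ((T ^^ i) x) ((T ^^ i) y)) ` {..<n})"

definition ecard :: "'a set \<Rightarrow> enat" where
  "ecard F = (if finite F then enat (card F) else \<infinity>)"

definition elog :: "enat \<Rightarrow> ereal" where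
  "elog N = (case N of enat k \<Rightarrow> if k = 0 then -\<infinity> else ereal (ln (real k)) | \<infinity> \<Rightarrow> \<infinity>)"

definition spanning ::
  "'a set \<Rightarrow> ('a \<Rightarrow> 'a \<Rightarrow> real) \<Rightarrow> ('a \<Rightarrow> 'a) \<Rightarrow> 'a set \<Rightarrow> nat \<Rightarrow> real \<Rightarrow> 'a set \<Rightarrow> bool" where
  "spanning X d T K n \<epsilon> F \<longleftrightarrow> F \<subseteq> X \<and> (\<forall>x\<in>K. \<exists>y\<in>F. dyn_dist d T n x y \<le> \<epsilon>)"

text \<open>An infimum in \<^typ>\<open>enat\<close> of a nonempty set is attained, so this is the smallest cardinality.\<close>

definition span_num ::
  "'a set \<Rightarrow> ('a \<Rightarrow> 'a \<Rightarrow> real) \<Rightarrow> ('a \<Rightarrow> 'a) \<Rightarrow> 'a set \<Rightarrow> nat \<Rightarrow> real \<Rightarrow> enat" where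
  "span_num X d T K n \<epsilon> = Inf {ecard F | F. spanning X d T K n \<epsilon> F}"

definition bowen_entropy :: "'a set \<Rightarrow> ('a \<Rightarrow> 'a \<Rightarrow> real) \<Rightarrow> ('a \<Rightarrow> 'a) \<Rightarrow> ereal" where
  "bowen_entropy X d T =
     (SUP K \<in> {K. compactin (Metric_space.mtopology X d) K}.
        Lim (at_right 0) (\<lambda>\<epsilon>. limsup (\<lambda>n. elog (span_num X d T K n \<epsilon>) / ereal (real n))))"

definition qspanning ::
  "'a set \<Rightarrow> ('a \<Rightarrow> 'a \<Rightarrow> real) \<Rightarrow> ('a \<Rightarrow> 'a) \<Rightarrow> 'a set \<Rightarrow> nat \<Rightarrow> real \<Rightarrow> 'a set \<Rightarrow> bool" where
  "qspanning X e T K n \<epsilon> F \<longleftrightarrow>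
     F \<subseteq> X \<and> (\<forall>x\<in>K. \<exists>y\<in>F. dyn_dist e T n x y \<le> \<epsilon> \<and> dyn_dist e T n y x \<le> \<epsilon>)"

definition qspan_num ::
  "'a set \<Rightarrow> ('a \<Rightarrow> 'a \<Rightarrow> real) \<Rightarrow> ('a \<Rightarrow> 'a) \<Rightarrow> 'a set \<Rightarrow> nat \<Rightarrow> real \<Rightarrow> enat" where
  "qspan_num X e T K n \<epsilon> = Inf {ecard F | F. qspanning X e T K n \<epsilon> F}"

definition qentropy :: "'a set \<Rightarrow> ('a \<Rightarrow> 'a \<Rightarrow> real) \<Rightarrow> ('a \<Rightarrow> 'a) \<Rightarrow> ereal" where
  "qentropy X e T =
     (SUP K \<in> {K. compactin (qtopology X e) K}.
        Lim (at_right 0) (\<lambda>\<epsilon>. limsup (\<lambda>n. elog (qspan_num X e T K n \<epsilon>) / ereal (real n))))"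

context Quasi_metric_space
begin

lemma Metric_space_sym_metric: "Metric_space X (sym_metric e)"
proof
  show "0 \<le> sym_metric e x y" for x y
    by (simp add: sym_metric_def nonneg)
  show "sym_metric e x y = sym_metric e y x" for x y
    by (simp add: sym_metric_def)
  show "sym_metric e x y = 0 \<longleftrightarrow> x = y" if "x \<in> X" "y \<in> X" for x y
    using zero[OF that] zero[OF that(2,1)] nonneg[of x y] nonneg[of y x]
    by (auto simp: sym_metric_def)
  show "sym_metric e x z \<le> sym_metric e x y + sym_metric e y z"
    if "x \<in> X" "y \<in> X" "z \<in> X" for x y z
    using triangle[OF that] triangle[OF that(3,2,1)] unfolding sym_metric_def by argo
qed

lemma qtopology_eq_mtopology: "qtopology X e = Metric_space.mtopology X (sym_metric e)"
proof -
  interpret D: Metric_space X "sym_metric e" by (rule Metric_space_sym_metric)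
  have ball_open: "openin D.mtopology (qball X e p t)" if p: "p \<in> X" for p t
    unfolding D.openin_mtopology
  proof (intro conjI allI impI)
    show "qball X e p t \<subseteq> X" by (auto simp: qball_def)
    fix x assume x: "x \<in> qball X e p t"
    then have xX: "x \<in> X" and lt: "e x p < t" "e p x < t" by (auto simp: qball_def)
    define r where "r = min (t - e x p) (t - e p x) / 2"
    have "r > 0" using lt by (simp add: r_def)
    moreover have "D.mball x r \<subseteq> qball X e p t"
    proof
      fix y assume "y \<in> D.mball x r"
      then have yX: "y \<in> X" and d: "e x y + e y x < min (t - e x p) (t - e p x)"
        by (auto simp: sym_metric_def r_def)
      show "y \<in> qball X e p t"
        using triangle[OF yX xX p] triangle[OF p xX yX] nonneg[of x y] nonneg[of y x] d yX
        by (auto simp: qball_def)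
    qed
    ultimately show "\<exists>r>0. D.mball x r \<subseteq> qball X e p t" by blast
  qed
  have le: "openin D.mtopology U" if "generate_topology_on {qball X e p t | p t. p \<in> X \<and> 0 < t} U" for U
    using that by induction (auto intro: ball_open)
  have ge: "openin (qtopology X e) U" if U: "openin D.mtopology U" for U
  proof (subst openin_subopen, intro ballI)
    fix x assume x: "x \<in> U"
    then obtain r where r: "r > 0" "D.mball x r \<subseteq> U" and xX: "x \<in> X"
      using U unfolding D.openin_mtopology by blast
    have "openin (qtopology X e) (qball X e x r)"
      unfolding qtopology_def using xX r by (intro topology_generated_by_Basis) auto
    moreover have "x \<in> qball X e x r"
      using xX r zero[of x x] by (simp add: qball_def)
    moreover have "qball X e x r \<subseteq> D.mball x r"
      using xX by (auto simp: qball_def sym_metric_def)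
    ultimately show "\<exists>V. openin (qtopology X e) V \<and> x \<in> V \<and> V \<subseteq> U"
      using r by blast
  qed
  show ?thesis
    using le ge by (auto simp: topology_eq qtopology_def openin_topology_generated_by_iff)
qed

end

end

theory Submission
  imports Defs
begin

text \<open>
  The distances \<open>e\<close> and \<open>d\<^sub>e\<close> control one another: if \<open>e x y\<close> and \<open>e y x\<close> are both at most
  \<open>\<epsilon>\<close>, so is their mean \<open>d\<^sub>e x y\<close>, and conversely each of them is at most \<open>2 d\<^sub>e x y\<close>, because
  the other one is nonnegative. These comparisons are uniform, hence they hold along whole orbit
  segments, and they give

    \<open>qspan_num (2\<epsilon>) \<le> span_num \<epsilon> \<le> qspan_num \<epsilon>\<close>

  for every \<open>K\<close> and every \<open>n \<ge> 1\<close>; the exponential growth rates in \<open>n\<close> then satisfy the same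
  inequalities. A growth rate can only increase as \<open>\<epsilon>\<close> decreases to \<open>0\<close>, so its limit is its
  supremum over \<open>\<epsilon> > 0\<close> (lemma \<open>Lim_at_right_antimono\<close>), and replacing \<open>\<epsilon>\<close> by \<open>2\<epsilon>\<close> does not
  change that supremum. Thus the two limits agree for every \<open>K\<close>. Since \<open>e\<close> and \<open>d\<^sub>e\<close> induce the
  same topology, both entropies are suprema over the same compact sets.
\<close>

lemma dyn_dist_le_iff:
  assumes "0 < n"
  shows "dyn_dist d T n x y \<le> \<epsilon> \<longleftrightarrow> (\<forall>i<n. d ((T ^^ i) x) ((T ^^ i) y) \<le> \<epsilon>)"
  using assms unfolding dyn_dist_def by (subst Max_le_iff) auto

lemma spanning_mono: "spanning X d T K n \<delta> F \<Longrightarrow> \<delta> \<le> \<epsilon> \<Longrightarrow> spanning X d T K n \<epsilon> F"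
  unfolding spanning_def by (meson order_trans)

lemma qspanning_mono: "qspanning X e T K n \<delta> F \<Longrightarrow> \<delta> \<le> \<epsilon> \<Longrightarrow> qspanning X e T K n \<epsilon> F"
  unfolding qspanning_def by (meson order_trans)

lemma spanning_sym_metric_if_qspanning:
  assumes n: "0 < n" and F: "qspanning X e T K n \<epsilon> F"
  shows "spanning X (sym_metric e) T K n \<epsilon> F"
proof -
  have "dyn_dist (sym_metric e) T n x y \<le> \<epsilon>"
    if "dyn_dist e T n x y \<le> \<epsilon>" "dyn_dist e T n y x \<le> \<epsilon>" for x y
    using that unfolding dyn_dist_le_iff[OF n] sym_metric_def by fastforce
  then show ?thesis
    using F unfolding spanning_def qspanning_def by meson
qed

lemma qspanning_if_spanning_sym_metric:
  assumes nonneg: "\<And>x y. 0 \<le> e x y" and n: "0 < n"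
    and F: "spanning X (sym_metric e) T K n \<epsilon> F"
  shows "qspanning X e T K n (2 * \<epsilon>) F"
proof -
  have e_le: "e a b \<le> 2 * \<epsilon> \<and> e b a \<le> 2 * \<epsilon>" if "sym_metric e a b \<le> \<epsilon>" for a b
    using that nonneg[of a b] nonneg[of b a] unfolding sym_metric_def by argo
  have "dyn_dist e T n x y \<le> 2 * \<epsilon> \<and> dyn_dist e T n y x \<le> 2 * \<epsilon>"
    if "dyn_dist (sym_metric e) T n x y \<le> \<epsilon>" for x y
    using that e_le unfolding dyn_dist_le_iff[OF n] by blast
  then show ?thesis
    using F unfolding spanning_def qspanning_def by meson
qed

lemma mono_elog: "mono elog"
  by (rule monoI) (auto simp: elog_def split: enat.splits)

text \<open>
  The index \<open>n = 0\<close> is excluded because \<open>dyn_dist\<close> is then the maximum of an empty set, an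
  unspecified number, so that spanning numbers of different distances cannot be compared there.
\<close>

lemma growth_rate_mono:
  assumes "\<And>n. 0 < n \<Longrightarrow> N n \<le> M n"
  shows "limsup (\<lambda>n. elog (N n) / ereal (real n)) \<le> limsup (\<lambda>n. elog (M n) / ereal (real n))"
proof (rule Limsup_mono)
  show "\<forall>\<^sub>F n in sequentially. elog (N n) / ereal (real n) \<le> elog (M n) / ereal (real n)"
    using eventually_gt_at_top[of 0]
  proof eventually_elim
    case (elim n)
    then show ?case
      using monoD[OF mono_elog assms] by (intro ereal_divide_right_mono) auto
  qed
qed

lemma Lim_at_right_antimono:
  fixes f :: "real \<Rightarrow> 'b :: {complete_linorder, linorder_topology}"
  assumes anti: "\<And>x y. a < x \<Longrightarrow> x \<le> y \<Longrightarrow> f y \<le> f x"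
  shows "Lim (at_right a) f = (SUP x\<in>{a<..}. f x)"
proof (rule tendsto_Lim)
  show "(f \<longlongrightarrow> (SUP x\<in>{a<..}. f x)) (at_right a)"
  proof (rule order_tendstoI)
    fix l assume "l < (SUP x\<in>{a<..}. f x)"
    then obtain y where y: "a < y" "l < f y"
      by (auto simp: less_SUP_iff)
    have "\<forall>\<^sub>F x in at_right a. x \<in> {a<..<y}"
      using y(1) by (rule eventually_at_right_real)
    then show "\<forall>\<^sub>F x in at_right a. l < f x"
    proof eventually_elim
      case (elim x)
      then show ?case using y(2) anti[of x y] by auto
    qed
  next
    fix u assume u: "(SUP x\<in>{a<..}. f x) < u"
    show "\<forall>\<^sub>F x in at_right a. f x < u"
      using eventually_at_right_less[of a]
    proof eventually_elim
      case (elim x)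
      then show ?case by (intro le_less_trans[OF SUP_upper u]) auto
    qed
  qed
qed simp

text \<open>
  The two limits are compared as suprema over \<open>\<epsilon> > 0\<close>: the term at \<open>\<epsilon>\<close> on the left is dominated by
  the one at \<open>\<epsilon>\<close> on the right, which in turn is dominated by the one at \<open>\<epsilon> / 2\<close> on the left.
\<close>

lemma Lim_growth_rate_sym_metric:
  assumes nonneg: "\<And>x y. 0 \<le> e x y"
  shows "Lim (at_right 0)
      (\<lambda>\<epsilon>. limsup (\<lambda>n. elog (span_num X (sym_metric e) T K n \<epsilon>) / ereal (real n))) =
    Lim (at_right 0) (\<lambda>\<epsilon>. limsup (\<lambda>n. elog (qspan_num X e T K n \<epsilon>) / ereal (real n)))"
    (is "Lim _ ?s = Lim _ ?q")
proof -
  have s_anti: "?s \<epsilon> \<le> ?s \<delta>" if "\<delta> \<le> \<epsilon>" for \<delta> \<epsilon>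
    using that unfolding span_num_def
    by (intro growth_rate_mono Inf_superset_mono) (auto intro: spanning_mono)
  have q_anti: "?q \<epsilon> \<le> ?q \<delta>" if "\<delta> \<le> \<epsilon>" for \<delta> \<epsilon>
    using that unfolding qspan_num_def
    by (intro growth_rate_mono Inf_superset_mono) (auto intro: qspanning_mono)
  have s_le_q: "?s \<epsilon> \<le> ?q \<epsilon>" for \<epsilon>
    unfolding span_num_def qspan_num_def
    by (intro growth_rate_mono Inf_superset_mono) (auto intro: spanning_sym_metric_if_qspanning)
  have q_le_s: "?q \<epsilon> \<le> ?s (\<epsilon> / 2)" for \<epsilon>
    unfolding span_num_def qspan_num_def
    using qspanning_if_spanning_sym_metric[of e _ X T K "\<epsilon> / 2", OF nonneg]
    by (intro growth_rate_mono Inf_superset_mono) auto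
  have "Lim (at_right 0) ?s = (SUP \<epsilon>\<in>{0<..}. ?s \<epsilon>)"
    by (intro Lim_at_right_antimono s_anti)
  also have "\<dots> = (SUP \<epsilon>\<in>{0<..}. ?q \<epsilon>)"
  proof (rule antisym)
    show "(SUP \<epsilon>\<in>{0<..}. ?s \<epsilon>) \<le> (SUP \<epsilon>\<in>{0<..}. ?q \<epsilon>)"
      by (intro SUP_mono') (rule s_le_q)
    show "(SUP \<epsilon>\<in>{0<..}. ?q \<epsilon>) \<le> (SUP \<epsilon>\<in>{0<..}. ?s \<epsilon>)"
    proof (rule SUP_least)
      fix \<epsilon> :: real assume "\<epsilon> \<in> {0<..}"
      then have "?s (\<epsilon> / 2) \<le> (SUP \<epsilon>\<in>{0<..}. ?s \<epsilon>)"
        by (intro SUP_upper) auto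
      with q_le_s show "?q \<epsilon> \<le> (SUP \<epsilon>\<in>{0<..}. ?s \<epsilon>)"
        by (rule order_trans)
    qed
  qed
  also have "\<dots> = Lim (at_right 0) ?q"
    by (intro Lim_at_right_antimono[symmetric] q_anti)
  finally show ?thesis .
qed

theorem theorem3p1:
  fixes X :: "'a set" and e :: "'a \<Rightarrow> 'a \<Rightarrow> real" and T :: "'a \<Rightarrow> 'a"
  assumes "Quasi_metric_space X e"
    and "continuous_map (qtopology X e) (qtopology X e) T"
  shows "bowen_entropy X (sym_metric e) T = qentropy X e T"
proof -
  interpret Quasi_metric_space X e by fact
  show ?thesis
    unfolding bowen_entropy_def qentropy_def qtopology_eq_mtopology
    by (simp only: Lim_growth_rate_sym_metric[OF nonneg])
qed

end
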